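(* Let $f:A\to B$ and $g:A\to C$ be ring homomorphisms, and let $J$ be an ideal of $B$ and $J'$ an ideal of $C$ such that $I_o:=f^{-1}(J)=g^{-1}(J')$. Consider the following conditions: \begin{itemize} \item[(a)] $f(A)+J$ is reduced and $J'\cap\operatorname{Nil}(C)=0$; \item[(b)] $g(A)+J'$ is reduced and $J\cap\operatorname{Nil}(B)=0$; \item[(c)] $A\bowtie^{f,g}(J,J')$ is reduced; \item[(d)] $J\cap\operatorname{Nil}(B)=0$ and $J'\cap\operatorname{Nil}(C)=0$. \end{itemize} Then: \begin{enumerate} \item ((a) or (b)) implies (c), and (c) implies (d). \item If $I_o$ is a radical ideal of $A$, then the four conditions (a), (b), (c), (d) are equivalent. \item If $f$ is surjective and $\operatorname{Ker}(f)\subseteq\operatorname{Ker}(g)$, then $A\bowtie^{f,g}(J,J')$ is reduced if and only if $B$ is reduced and $J'\cap\operatorname{Nil}(C)=0$. \end{enumerate}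
   Context: All rings are commutative with unity, and ring homomorphisms are unital. The bi-amalgamation of $A$ with $(B,C)$ along $(J,J')$ with respect to $(f,g)$ is the subring of $B\times C$ $$A\bowtie^{f,g}(J,J'):=\{(f(a)+j,\,g(a)+j')\mid a\in A,\ (j,j')\in J\times J'\}.$$ Here $f(A)+J=\{f(a)+j\mid a\in A, j\in J\}$ is a subring of $B$ and $g(A)+J'$ is a subring of $C$ (defined analogously). $\operatorname{Nil}(R)$ denotes the set of nilpotent elements (nilradical) of a ring $R$; an ideal is radical if it equals its own radical. *)

theory Defs
  imports "HOL-Algebra.Algebra"
begin

definition nilradical :: "('a, 'm) ring_scheme \<Rightarrow> 'a set" where
  "nilradical R = {x \<in> carrier R. \<exists>n::nat. n > 0 \<and> x [^]\<^bsub>R\<^esub> n = \<zero>\<^bsub>R\<^esub>}"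

definition reduced_ring :: "('a, 'm) ring_scheme \<Rightarrow> bool" where
  "reduced_ring R \<longleftrightarrow> nilradical R = {\<zero>\<^bsub>R\<^esub>}"

definition radical_of :: "('a, 'm) ring_scheme \<Rightarrow> 'a set \<Rightarrow> 'a set" where
  "radical_of R I = {x \<in> carrier R. \<exists>n::nat. n > 0 \<and> x [^]\<^bsub>R\<^esub> n \<in> I}"

definition radical_ideal :: "'a set \<Rightarrow> ('a, 'm) ring_scheme \<Rightarrow> bool" where
  "radical_ideal I R \<longleftrightarrow> ideal I R \<and> radical_of R I = I"

definition image_plus_ideal ::
  "('a, 'm) ring_scheme \<Rightarrow> ('b, 'n) ring_scheme \<Rightarrow> ('a \<Rightarrow> 'b) \<Rightarrow> 'b set \<Rightarrow> ('b, 'n) ring_scheme"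
  where
  "image_plus_ideal A B f J = B \<lparr> carrier := f ` carrier A <+>\<^bsub>B\<^esub> J \<rparr>"

definition biamalgamation ::
  "('a, 'm) ring_scheme \<Rightarrow> ('b, 'n) ring_scheme \<Rightarrow> ('c, 'k) ring_scheme \<Rightarrow>
   ('a \<Rightarrow> 'b) \<Rightarrow> ('a \<Rightarrow> 'c) \<Rightarrow> 'b set \<Rightarrow> 'c set \<Rightarrow> ('b \<times> 'c) ring" where
  "biamalgamation A B C f g J J' = (RDirProd B C)
     \<lparr> carrier := {(f a \<oplus>\<^bsub>B\<^esub> j, g a \<oplus>\<^bsub>C\<^esub> j') | a j j'. a \<in> carrier A \<and> j \<in> J \<and> j' \<in> J'} \<rparr>"

lemma RDirProd_cring:
  assumes "cring B" "cring C"
  shows "cring (RDirProd B C)"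
proof -
  interpret B: cring B by fact
  interpret C: cring C by fact
  interpret P: ring "RDirProd B C"
    by (rule RDirProd_ring) unfold_locales
  show ?thesis
    by (unfold_locales)
       (auto simp: RDirProd_def DirProd_def monoid.defs B.m_comm C.m_comm)
qed

lemma carrier_image_plus_ideal:
  "carrier (image_plus_ideal A B f J) = {f a \<oplus>\<^bsub>B\<^esub> j | a j. a \<in> carrier A \<and> j \<in> J}"
  by (auto simp: image_plus_ideal_def set_add_def')

lemma image_plus_ideal_subring:
  assumes "cring A" "cring B" "f \<in> ring_hom A B" "ideal J B"
  shows "subring (carrier (image_plus_ideal A B f J)) B"
proof -
  interpret f: ring_hom_cring A B f
    using assms by (simp add: ring_hom_cring_def ring_hom_cring_axioms_def)
  interpret J: ideal J B by fact
  note [simp] = J.a_Hcarr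
  show ?thesis
    unfolding carrier_image_plus_ideal
  proof (rule f.S.subringI, goal_cases)
    case 1 show ?case by auto
  next
    case 2
    have "\<one>\<^bsub>B\<^esub> = f \<one>\<^bsub>A\<^esub> \<oplus>\<^bsub>B\<^esub> \<zero>\<^bsub>B\<^esub>" by simp
    then show ?case using J.zero_closed by blast
  next
    case (3 h)
    then obtain a j where h: "h = f a \<oplus>\<^bsub>B\<^esub> j" "a \<in> carrier A" "j \<in> J" by auto
    then have "\<ominus>\<^bsub>B\<^esub> h = f (\<ominus>\<^bsub>A\<^esub> a) \<oplus>\<^bsub>B\<^esub> \<ominus>\<^bsub>B\<^esub> j"
      by (simp add: f.S.minus_add)
    then show ?case using h J.a_inv_closed f.R.a_inv_closed by blast
  next
    case (4 h h')
    then obtain a j b k where h: "h = f a \<oplus>\<^bsub>B\<^esub> j" "a \<in> carrier A" "j \<in> J"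
      "h' = f b \<oplus>\<^bsub>B\<^esub> k" "b \<in> carrier A" "k \<in> J" by auto
    then have "h \<otimes>\<^bsub>B\<^esub> h' = f (a \<otimes>\<^bsub>A\<^esub> b) \<oplus>\<^bsub>B\<^esub> (f a \<otimes>\<^bsub>B\<^esub> k \<oplus>\<^bsub>B\<^esub> j \<otimes>\<^bsub>B\<^esub> (f b \<oplus>\<^bsub>B\<^esub> k))"
      by (simp add: f.S.l_distr f.S.r_distr f.S.a_ac)
    moreover have "f a \<otimes>\<^bsub>B\<^esub> k \<oplus>\<^bsub>B\<^esub> j \<otimes>\<^bsub>B\<^esub> (f b \<oplus>\<^bsub>B\<^esub> k) \<in> J"
      using h by (simp add: J.I_l_closed J.I_r_closed)
    ultimately show ?case using h f.R.m_closed by blast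
  next
    case (5 h h')
    then obtain a j b k where h: "h = f a \<oplus>\<^bsub>B\<^esub> j" "a \<in> carrier A" "j \<in> J"
      "h' = f b \<oplus>\<^bsub>B\<^esub> k" "b \<in> carrier A" "k \<in> J" by auto
    then have "h \<oplus>\<^bsub>B\<^esub> h' = f (a \<oplus>\<^bsub>A\<^esub> b) \<oplus>\<^bsub>B\<^esub> (j \<oplus>\<^bsub>B\<^esub> k)"
      by (simp add: f.S.a_ac)
    then show ?case using h f.R.a_closed J.a_closed by blast
  qed
qed

lemma biamalgamation_subring:
  assumes "cring A" "cring B" "cring C" "f \<in> ring_hom A B" "g \<in> ring_hom A C"
    and "ideal J B" "ideal J' C"
  shows "subring (carrier (biamalgamation A B C f g J J')) (RDirProd B C)"
proof -
  interpret B: cring B by fact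
  interpret C: cring C by fact
  interpret P: cring "RDirProd B C" by (rule RDirProd_cring) fact+
  interpret J: ideal J B by fact
  interpret J': ideal J' C by fact
  have J_prod: "ideal (J \<times> J') (RDirProd B C)"
  proof (rule idealI)
    show "ring (RDirProd B C)" by (rule P.ring_axioms)
    show "subgroup (J \<times> J') (add_monoid (RDirProd B C))"
      unfolding RDirProd_add_monoid
      by (rule DirProd_subgroups) (rule B.a_group C.a_group J.a_subgroup J'.a_subgroup)+
  qed (auto simp: RDirProd_def DirProd_def monoid.defs
         J.I_l_closed J.I_r_closed J'.I_l_closed J'.I_r_closed)
  have fg: "(\<lambda>a. (f a, g a)) \<in> ring_hom A (RDirProd B C)"
    using assms(4,5)
    by (auto simp: ring_hom_def RDirProd_def DirProd_def monoid.defs)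
  have "carrier (biamalgamation A B C f g J J') =
        carrier (image_plus_ideal A (RDirProd B C) (\<lambda>a. (f a, g a)) (J \<times> J'))"
    unfolding carrier_image_plus_ideal
    by (force simp: biamalgamation_def RDirProd_def DirProd_def monoid.defs)
  with image_plus_ideal_subring[OF assms(1) P.is_cring fg J_prod] show ?thesis by simp
qed

end

theory Submission
  imports Defs
begin

text \<open>
  An element \<open>(f a + j, g a + j')\<close> is nilpotent iff both components are, and since
  \<open>f\<inverse>(J) = g\<inverse>(J')\<close>, its first component lies in \<open>J\<close> iff its second lies in \<open>J'\<close>.
  So if the first component vanishes, then the second is a nilpotent of \<open>J'\<close>, which gives
  (a) \<open>\<Longrightarrow>\<close> (c) and, by symmetry, (b) \<open>\<Longrightarrow>\<close> (c); evaluating at \<open>a = 0\<close> gives (c) \<open>\<Longrightarrow>\<close> (d). If \<open>I\<^sub>o\<close> is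
  radical, a nilpotent \<open>f a + j\<close> has \<open>f (a\<^sup>n) \<in> J\<close>, hence \<open>a \<in> I\<^sub>o\<close> and \<open>f a + j \<in> J\<close>, so (d) gives
  back (a) and (b). If \<open>f\<close> is surjective with \<open>Ker f \<subseteq> Ker g\<close>, every nilpotent of \<open>B\<close> is some
  \<open>f a\<close>, and then \<open>(f a, g a)\<close> is nilpotent.
\<close>

section \<open>Nilradicals of subrings and direct products\<close>

lemma (in ring) zero_in_nilradical: "\<zero> \<in> nilradical R"
  unfolding nilradical_def by (auto intro!: exI[of _ "1::nat"])

lemma (in monoid) nat_pow_carrier_update: "x [^]\<^bsub>G\<lparr>carrier := S\<rparr>\<^esub> (n::nat) = x [^] n"
  by (simp add: nat_pow_def)

lemma (in ring) nilradical_subring: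
  assumes "subring S R"
  shows "nilradical (R\<lparr>carrier := S\<rparr>) = S \<inter> nilradical R"
  using subringE(1)[OF assms] by (auto simp: nilradical_def nat_pow_carrier_update)

text \<open>Powers and zero of a subring are those of \<open>R\<close>, so only the nilpotents of
  \<open>R\<close> lying in \<open>S\<close> matter. Both constructions of the theorem are carrier
  updates of this kind.\<close>

lemma (in ring) reduced_subring_iff:
  assumes "subring S R"
  shows "reduced_ring (R\<lparr>carrier := S\<rparr>) \<longleftrightarrow> S \<inter> nilradical R \<subseteq> {\<zero>}"
  unfolding reduced_ring_def nilradical_subring[OF assms]
  using subringE(2)[OF assms] zero_in_nilradical by auto

lemma (in ring) ideal_inter_nilradical_eq_zero_iff:
  assumes "ideal I R"
  shows "I \<inter> nilradical R = {\<zero>} \<longleftrightarrow> I \<inter> nilradical R \<subseteq> {\<zero>}"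
  using additive_subgroup.zero_closed[OF ideal.axioms(1)[OF assms]] zero_in_nilradical by auto

lemma (in ring) nat_pow_eq_zero_mono:
  assumes "x \<in> carrier R" "x [^] (m::nat) = \<zero>" "m \<le> n"
  shows "x [^] n = \<zero>"
proof -
  have "x [^] n = x [^] m \<otimes> x [^] (n - m)"
    using nat_pow_mult[OF assms(1), of m "n - m"] assms(3) by simp
  then show ?thesis
    using assms by simp
qed

lemma RDirProd_nat_pow:
  "(x, y) [^]\<^bsub>RDirProd R S\<^esub> (n::nat) = (x [^]\<^bsub>R\<^esub> n, y [^]\<^bsub>S\<^esub> n)"
  by (induction n) (simp_all add: nat_pow_def RDirProd_def DirProd_def monoid.defs)

lemma RDirProd_zero: "\<zero>\<^bsub>RDirProd R S\<^esub> = (\<zero>\<^bsub>R\<^esub>, \<zero>\<^bsub>S\<^esub>)"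
  by (simp add: RDirProd_def DirProd_def monoid.defs)

lemma nilradical_RDirProd:
  assumes "ring R" "ring S"
  shows "nilradical (RDirProd R S) = nilradical R \<times> nilradical S"
proof (intro equalityI subsetI)
  fix z assume "z \<in> nilradical (RDirProd R S)"
  then show "z \<in> nilradical R \<times> nilradical S"
    by (cases z) (auto simp: nilradical_def RDirProd_carrier RDirProd_nat_pow RDirProd_zero)
next
  fix z assume "z \<in> nilradical R \<times> nilradical S"
  then obtain x y and m n :: nat where z: "z = (x, y)"
    and x: "x \<in> carrier R" "x [^]\<^bsub>R\<^esub> m = \<zero>\<^bsub>R\<^esub>" "m > 0"
    and y: "y \<in> carrier S" "y [^]\<^bsub>S\<^esub> n = \<zero>\<^bsub>S\<^esub>"
    by (auto simp: nilradical_def)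
  \<comment> \<open>The two nilpotency exponents may differ, and a nilpotent pair needs a common
    one; \<open>m > 0\<close> makes the maximum positive.\<close>
  have "x [^]\<^bsub>R\<^esub> (max m n) = \<zero>\<^bsub>R\<^esub>" "y [^]\<^bsub>S\<^esub> (max m n) = \<zero>\<^bsub>S\<^esub>"
    using ring.nat_pow_eq_zero_mono[OF assms(1) x(1,2)]
      ring.nat_pow_eq_zero_mono[OF assms(2) y] by auto
  then show "z \<in> nilradical (RDirProd R S)"
    using x y z
    by (auto simp: nilradical_def RDirProd_carrier RDirProd_nat_pow RDirProd_zero
        intro!: exI[of _ "max m n"])
qed

section \<open>Elementwise criteria for reducedness\<close>

lemma reduced_image_plus_ideal_iff:
  assumes "cring A" "cring B" "f \<in> ring_hom A B" "ideal J B"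
  shows "reduced_ring (image_plus_ideal A B f J) \<longleftrightarrow>
    (\<forall>a\<in>carrier A. \<forall>j\<in>J. f a \<oplus>\<^bsub>B\<^esub> j \<in> nilradical B \<longrightarrow> f a \<oplus>\<^bsub>B\<^esub> j = \<zero>\<^bsub>B\<^esub>)"
proof -
  \<comment> \<open>This puts the ring into the shape to which \<open>reduced_subring_iff\<close>
    applies.\<close>
  have "image_plus_ideal A B f J = B\<lparr>carrier := carrier (image_plus_ideal A B f J)\<rparr>"
    by (simp add: image_plus_ideal_def)
  then have "reduced_ring (image_plus_ideal A B f J) \<longleftrightarrow>
      carrier (image_plus_ideal A B f J) \<inter> nilradical B \<subseteq> {\<zero>\<^bsub>B\<^esub>}"
    using ring.reduced_subring_iff[OF cring.axioms(1)[OF assms(2)]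
        image_plus_ideal_subring[OF assms]] by simp
  then show ?thesis
    unfolding carrier_image_plus_ideal by blast
qed

lemma reduced_biamalgamation_iff:
  assumes "cring A" "cring B" "cring C" "f \<in> ring_hom A B" "g \<in> ring_hom A C"
    and "ideal J B" "ideal J' C"
  shows "reduced_ring (biamalgamation A B C f g J J') \<longleftrightarrow>
    (\<forall>a\<in>carrier A. \<forall>j\<in>J. \<forall>j'\<in>J'.
      f a \<oplus>\<^bsub>B\<^esub> j \<in> nilradical B \<and> g a \<oplus>\<^bsub>C\<^esub> j' \<in> nilradical C \<longrightarrow>
      f a \<oplus>\<^bsub>B\<^esub> j = \<zero>\<^bsub>B\<^esub> \<and> g a \<oplus>\<^bsub>C\<^esub> j' = \<zero>\<^bsub>C\<^esub>)"
proof -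
  have rings: "ring B" "ring C"
    using assms by (auto dest: cring.axioms)
  have "biamalgamation A B C f g J J' =
      (RDirProd B C)\<lparr>carrier := carrier (biamalgamation A B C f g J J')\<rparr>"
    by (simp add: biamalgamation_def)
  then have "reduced_ring (biamalgamation A B C f g J J') \<longleftrightarrow>
      carrier (biamalgamation A B C f g J J') \<inter> nilradical B \<times> nilradical C
        \<subseteq> {(\<zero>\<^bsub>B\<^esub>, \<zero>\<^bsub>C\<^esub>)}"
    using ring.reduced_subring_iff[OF RDirProd_ring[OF rings] biamalgamation_subring[OF assms]]
    by (simp add: nilradical_RDirProd[OF rings] RDirProd_zero)
  then show ?thesis
    by (auto simp: biamalgamation_def)
qed

text \<open>The elementwise criterion is symmetric in the two coordinates. This lets each result
  proved for the \<open>B\<close> side be reused for the \<open>C\<close> side.\<close>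

lemma reduced_biamalgamation_commute:
  assumes "cring A" "cring B" "cring C" "f \<in> ring_hom A B" "g \<in> ring_hom A C"
    and "ideal J B" "ideal J' C"
  shows "reduced_ring (biamalgamation A B C f g J J') \<longleftrightarrow>
    reduced_ring (biamalgamation A C B g f J' J)"
  unfolding reduced_biamalgamation_iff[OF assms]
    reduced_biamalgamation_iff[OF assms(1,3,2,5,4,7,6)] by blast

section \<open>Implications between the four conditions\<close>

lemma add_mem_ideal_iff:
  assumes "ideal J R" "x \<in> carrier R" "j \<in> J"
  shows "x \<oplus>\<^bsub>R\<^esub> j \<in> J \<longleftrightarrow> x \<in> J"
proof -
  interpret ring R
    using assms(1) by (rule ideal.axioms)
  interpret J: ideal J R by fact
  have "x = (x \<oplus>\<^bsub>R\<^esub> j) \<oplus>\<^bsub>R\<^esub> \<ominus>\<^bsub>R\<^esub> j"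
    using assms J.a_Hcarr by (simp add: a_assoc r_neg)
  then show ?thesis
    using assms(3) J.a_closed J.a_inv_closed by metis
qed

lemma reduced_biamalgamation_if_reduced_image_plus_ideal:
  assumes "cring A" "cring B" "cring C" "f \<in> ring_hom A B" "g \<in> ring_hom A C"
    and "ideal J B" "ideal J' C"
    and preimages: "\<And>x. x \<in> carrier A \<Longrightarrow> f x \<in> J \<Longrightarrow> g x \<in> J'"
    and red: "reduced_ring (image_plus_ideal A B f J)"
    and nil: "J' \<inter> nilradical C = {\<zero>\<^bsub>C\<^esub>}"
  shows "reduced_ring (biamalgamation A B C f g J J')"
  unfolding reduced_biamalgamation_iff[OF assms(1-7)]
proof (intro ballI impI, elim conjE)
  fix a j j'
  assume a: "a \<in> carrier A" and j: "j \<in> J" and j': "j' \<in> J'"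
    and fa: "f a \<oplus>\<^bsub>B\<^esub> j \<in> nilradical B" and ga: "g a \<oplus>\<^bsub>C\<^esub> j' \<in> nilradical C"
  have zero: "f a \<oplus>\<^bsub>B\<^esub> j = \<zero>\<^bsub>B\<^esub>"
    using red a j fa reduced_image_plus_ideal_iff[OF assms(1,2,4,6)] by blast
  \<comment> \<open>The vanishing sum \<open>f a + j\<close> lies in \<open>J\<close>, and removing
    \<open>j\<close> leaves \<open>f a\<close> in \<open>J\<close>; this is what
    \<open>preimages\<close> can carry over to \<open>C\<close>.\<close>
  have "\<zero>\<^bsub>B\<^esub> \<in> J"
    using assms(6) by (simp add: ideal_def additive_subgroup.zero_closed)
  then have "f a \<in> J"
    using add_mem_ideal_iff[OF assms(6) ring_hom_closed[OF assms(4) a] j] zero by simp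
  then have "g a \<in> J'"
    using preimages a by blast
  then have "g a \<oplus>\<^bsub>C\<^esub> j' \<in> J'"
    using add_mem_ideal_iff[OF assms(7) ring_hom_closed[OF assms(5) a] j'] by simp
  then show "f a \<oplus>\<^bsub>B\<^esub> j = \<zero>\<^bsub>B\<^esub> \<and> g a \<oplus>\<^bsub>C\<^esub> j' = \<zero>\<^bsub>C\<^esub>"
    using zero ga nil by blast
qed

lemma ideal_inter_nilradical_if_reduced_biamalgamation:
  assumes "cring A" "cring B" "cring C" "f \<in> ring_hom A B" "g \<in> ring_hom A C"
    and "ideal J B" "ideal J' C"
    and red: "reduced_ring (biamalgamation A B C f g J J')"
  shows "J \<inter> nilradical B = {\<zero>\<^bsub>B\<^esub>}"
proof -
  interpret A: cring A by fact
  interpret B: cring B by fact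
  interpret C: cring C by fact
  interpret J: ideal J B by fact
  interpret J': ideal J' C by fact
  have [simp]: "f \<zero>\<^bsub>A\<^esub> = \<zero>\<^bsub>B\<^esub>" "g \<zero>\<^bsub>A\<^esub> = \<zero>\<^bsub>C\<^esub>"
    using ring_hom_zero[OF assms(4)] ring_hom_zero[OF assms(5)]
    by (simp_all add: A.ring_axioms B.ring_axioms C.ring_axioms)
  \<comment> \<open>The choice \<open>a = 0\<close>, \<open>j = x\<close>, \<open>j' = 0\<close>
    exhibits \<open>(x, 0)\<close> as a nilpotent element of the bi-amalgamation.\<close>
  have "x = \<zero>\<^bsub>B\<^esub>" if "x \<in> J" "x \<in> nilradical B" for x
    using red[unfolded reduced_biamalgamation_iff[OF assms(1-7)], rule_format,
        OF A.zero_closed that(1) J'.zero_closed] that J.a_Hcarr C.zero_in_nilradical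
    by simp
  then show ?thesis
    unfolding B.ideal_inter_nilradical_eq_zero_iff[OF assms(6)] by blast
qed

lemma reduced_image_plus_ideal_if_radical_preimage:
  assumes "cring A" "cring B" "f \<in> ring_hom A B" "ideal J B"
    and rad: "radical_ideal {x \<in> carrier A. f x \<in> J} A"
    and nil: "J \<inter> nilradical B = {\<zero>\<^bsub>B\<^esub>}"
  shows "reduced_ring (image_plus_ideal A B f J)"
  unfolding reduced_image_plus_ideal_iff[OF assms(1-4)]
proof (intro ballI impI)
  fix a j
  assume a: "a \<in> carrier A" and j: "j \<in> J" and fa: "f a \<oplus>\<^bsub>B\<^esub> j \<in> nilradical B"
  interpret f: ring_hom_cring A B f
    using assms by (simp add: ring_hom_cring_def ring_hom_cring_axioms_def)
  interpret J: ideal J B by fact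
  \<comment> \<open>Congruence of powers modulo \<open>J\<close>, with the error term
    \<open>i\<close> made explicit instead of passing to the quotient ring.\<close>
  have "\<exists>i\<in>J. (f a \<oplus>\<^bsub>B\<^esub> j) [^]\<^bsub>B\<^esub> n = f a [^]\<^bsub>B\<^esub> n \<oplus>\<^bsub>B\<^esub> i" for n :: nat
  proof (induction n)
    case 0
    show ?case by (auto intro!: bexI[of _ "\<zero>\<^bsub>B\<^esub>"] J.zero_closed)
  next
    case (Suc n)
    then obtain i where i: "i \<in> J" "(f a \<oplus>\<^bsub>B\<^esub> j) [^]\<^bsub>B\<^esub> n = f a [^]\<^bsub>B\<^esub> n \<oplus>\<^bsub>B\<^esub> i" by blast
    \<comment> \<open>The new error term collects every product having \<open>i\<close> or
      \<open>j\<close> as a factor.\<close>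
    have "(f a \<oplus>\<^bsub>B\<^esub> j) [^]\<^bsub>B\<^esub> Suc n =
        f a [^]\<^bsub>B\<^esub> Suc n \<oplus>\<^bsub>B\<^esub> (i \<otimes>\<^bsub>B\<^esub> f a \<oplus>\<^bsub>B\<^esub> (f a [^]\<^bsub>B\<^esub> n \<oplus>\<^bsub>B\<^esub> i) \<otimes>\<^bsub>B\<^esub> j)"
      using a j i J.a_Hcarr by (simp add: f.S.l_distr f.S.r_distr f.S.a_ac)
    moreover have "i \<otimes>\<^bsub>B\<^esub> f a \<oplus>\<^bsub>B\<^esub> (f a [^]\<^bsub>B\<^esub> n \<oplus>\<^bsub>B\<^esub> i) \<otimes>\<^bsub>B\<^esub> j \<in> J"
      using a j i J.a_Hcarr by (simp add: J.I_l_closed J.I_r_closed)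
    ultimately show ?case by blast
  qed
  moreover obtain n :: nat where "n > 0" "(f a \<oplus>\<^bsub>B\<^esub> j) [^]\<^bsub>B\<^esub> n = \<zero>\<^bsub>B\<^esub>"
    using fa by (auto simp: nilradical_def)
  ultimately obtain i where n: "n > 0" and i: "i \<in> J" "f a [^]\<^bsub>B\<^esub> n \<oplus>\<^bsub>B\<^esub> i = \<zero>\<^bsub>B\<^esub>"
    by metis
  have "f a [^]\<^bsub>B\<^esub> n \<in> J"
    using add_mem_ideal_iff[OF assms(4) _ i(1), of "f a [^]\<^bsub>B\<^esub> n"] a i(2) J.zero_closed by simp
  \<comment> \<open>Since \<open>f\<close> commutes with powers, a power of \<open>a\<close> lies in
    the preimage of \<open>J\<close>, and radicality then puts \<open>a\<close> itself
    there.\<close>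
  then have "a [^]\<^bsub>A\<^esub> n \<in> {x \<in> carrier A. f x \<in> J}"
    using a by simp
  then have "a \<in> radical_of A {x \<in> carrier A. f x \<in> J}"
    using a n by (auto simp: radical_of_def)
  then have "f a \<in> J"
    using rad by (simp add: radical_ideal_def)
  then show "f a \<oplus>\<^bsub>B\<^esub> j = \<zero>\<^bsub>B\<^esub>"
    using j fa nil by blast
qed

section \<open>The surjective case\<close>

text \<open>With this equality, condition (a) becomes the right-hand side of the third claim, so its
  "if" direction is an instance of (a) implies (c).\<close>

lemma image_plus_ideal_surj:
  assumes "ring B" "ideal J B" "f ` carrier A = carrier B"
  shows "image_plus_ideal A B f J = B"
proof -
  interpret B: ring B by fact
  interpret J: ideal J B by fact
  have "carrier B <+>\<^bsub>B\<^esub> J = carrier B"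
  proof
    show "carrier B <+>\<^bsub>B\<^esub> J \<subseteq> carrier B"
      using J.a_Hcarr by (auto simp: set_add_def')
    show "carrier B \<subseteq> carrier B <+>\<^bsub>B\<^esub> J"
    proof
      fix x assume x: "x \<in> carrier B"
      then have "x = x \<oplus>\<^bsub>B\<^esub> \<zero>\<^bsub>B\<^esub>" by simp
      then show "x \<in> carrier B <+>\<^bsub>B\<^esub> J"
        unfolding set_add_def' using x J.zero_closed by blast
    qed
  qed
  then show ?thesis
    by (simp add: image_plus_ideal_def assms(3))
qed

lemma reduced_codomain_if_reduced_biamalgamation:
  assumes "cring A" "cring B" "cring C" "f \<in> ring_hom A B" "g \<in> ring_hom A C"
    and "ideal J B" "ideal J' C"
    and surj: "f ` carrier A = carrier B" and ker: "a_kernel A B f \<subseteq> a_kernel A C g"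
    and red: "reduced_ring (biamalgamation A B C f g J J')"
  shows "reduced_ring B"
proof -
  interpret f: ring_hom_cring A B f
    using assms by (simp add: ring_hom_cring_def ring_hom_cring_axioms_def)
  interpret g: ring_hom_cring A C g
    using assms by (simp add: ring_hom_cring_def ring_hom_cring_axioms_def)
  interpret J: ideal J B by fact
  interpret J': ideal J' C by fact
  have "x = \<zero>\<^bsub>B\<^esub>" if x: "x \<in> nilradical B" for x
  proof -
    obtain a where a: "a \<in> carrier A" "x = f a"
      using x surj by (auto simp: nilradical_def)
    obtain n :: nat where n: "n > 0" "x [^]\<^bsub>B\<^esub> n = \<zero>\<^bsub>B\<^esub>"
      using x by (auto simp: nilradical_def)
    have "f (a [^]\<^bsub>A\<^esub> n) = \<zero>\<^bsub>B\<^esub>"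
      using f.hom_pow[OF a(1)] n(2) unfolding a(2) by metis
    \<comment> \<open>The kernel inclusion transfers the nilpotency of \<open>f a\<close> to
      \<open>g a\<close> with the same exponent; \<open>(f a, g a)\<close> is then the element with
      \<open>j = j' = 0\<close>.\<close>
    then have "a [^]\<^bsub>A\<^esub> n \<in> a_kernel A C g"
      using ker f.R.nat_pow_closed[OF a(1)] unfolding a_kernel_def' by blast
    then have "g a [^]\<^bsub>C\<^esub> n = \<zero>\<^bsub>C\<^esub>"
      using g.hom_pow[OF a(1)] unfolding a_kernel_def' by simp
    then have "g a \<in> nilradical C"
      using g.hom_closed[OF a(1)] n(1) unfolding nilradical_def by blast
    then show ?thesis
      using red[unfolded reduced_biamalgamation_iff[OF assms(1-7)], rule_format,
          OF a(1) J.zero_closed J'.zero_closed] a x by simp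
  qed
  then show ?thesis
    using f.S.zero_in_nilradical unfolding reduced_ring_def by blast
qed

theorem proposition4p7:
  fixes A :: "('a, 'm) ring_scheme" and B :: "('b, 'n) ring_scheme" and C :: "('c, 'k) ring_scheme"
    and f :: "'a \<Rightarrow> 'b" and g :: "'a \<Rightarrow> 'c"
    and J :: "'b set" and J' :: "'c set" and I\<^sub>o :: "'a set"
  assumes "cring A" and "cring B" and "cring C"
    and "f \<in> ring_hom A B" and "g \<in> ring_hom A C"
    and "ideal J B" and "ideal J' C"
    and "I\<^sub>o = {x \<in> carrier A. f x \<in> J}" and "I\<^sub>o = {x \<in> carrier A. g x \<in> J'}"
  shows
    "let a = (reduced_ring (image_plus_ideal A B f J) \<and> J' \<inter> nilradical C = {\<zero>\<^bsub>C\<^esub>});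
         b = (reduced_ring (image_plus_ideal A C g J') \<and> J \<inter> nilradical B = {\<zero>\<^bsub>B\<^esub>});
         c = reduced_ring (biamalgamation A B C f g J J');
         d = (J \<inter> nilradical B = {\<zero>\<^bsub>B\<^esub>} \<and> J' \<inter> nilradical C = {\<zero>\<^bsub>C\<^esub>})
     in ((a \<or> b \<longrightarrow> c) \<and> (c \<longrightarrow> d))
        \<and> (radical_ideal I\<^sub>o A \<longrightarrow> (a \<longleftrightarrow> b) \<and> (b \<longleftrightarrow> c) \<and> (c \<longleftrightarrow> d))
        \<and> (f ` carrier A = carrier B \<and> a_kernel A B f \<subseteq> a_kernel A C g
            \<longrightarrow> (c \<longleftrightarrow> reduced_ring B \<and> J' \<inter> nilradical C = {\<zero>\<^bsub>C\<^esub>}))"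
proof -
  \<comment> \<open>\<open>AC\<close> and \<open>ACB\<close> are \<open>AB\<close> and
    \<open>ABC\<close> with \<open>(B, f, J)\<close> and \<open>(C, g, J')\<close> exchanged; they
    serve the mirrored statements.\<close>
  note AB = assms(1,2,4,6) and AC = assms(1,3,5,7) and ABC = assms(1-7)
    and ACB = assms(1,3,2,5,4,7,6)
  note commute = reduced_biamalgamation_commute[OF ABC]
  have preimages: "f x \<in> J \<longleftrightarrow> g x \<in> J'" if "x \<in> carrier A" for x
    using assms(8,9) that by blast
  have ac: "reduced_ring (biamalgamation A B C f g J J')"
    if "reduced_ring (image_plus_ideal A B f J)" "J' \<inter> nilradical C = {\<zero>\<^bsub>C\<^esub>}"
    using reduced_biamalgamation_if_reduced_image_plus_ideal[OF ABC] preimages that by blast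
  have bc: "reduced_ring (biamalgamation A B C f g J J')"
    if "reduced_ring (image_plus_ideal A C g J')" "J \<inter> nilradical B = {\<zero>\<^bsub>B\<^esub>}"
    unfolding commute
    using reduced_biamalgamation_if_reduced_image_plus_ideal[OF ACB] preimages that by blast
  have cd: "J \<inter> nilradical B = {\<zero>\<^bsub>B\<^esub>}" "J' \<inter> nilradical C = {\<zero>\<^bsub>C\<^esub>}"
    if "reduced_ring (biamalgamation A B C f g J J')"
    using ideal_inter_nilradical_if_reduced_biamalgamation[OF ABC]
      ideal_inter_nilradical_if_reduced_biamalgamation[OF ACB] commute that by blast+
  have da: "reduced_ring (image_plus_ideal A B f J)"
    if "radical_ideal I\<^sub>o A" "J \<inter> nilradical B = {\<zero>\<^bsub>B\<^esub>}"
    using reduced_image_plus_ideal_if_radical_preimage[OF AB] that assms(8) by simp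
  have db: "reduced_ring (image_plus_ideal A C g J')"
    if "radical_ideal I\<^sub>o A" "J' \<inter> nilradical C = {\<zero>\<^bsub>C\<^esub>}"
    using reduced_image_plus_ideal_if_radical_preimage[OF AC] that
    unfolding assms(9) by blast
  have surj: "image_plus_ideal A B f J = B" if "f ` carrier A = carrier B"
    using image_plus_ideal_surj[OF cring.axioms(1)[OF assms(2)] assms(6) that] .
  have cB: "reduced_ring B"
    if "f ` carrier A = carrier B" "a_kernel A B f \<subseteq> a_kernel A C g"
      "reduced_ring (biamalgamation A B C f g J J')"
    using reduced_codomain_if_reduced_biamalgamation[OF ABC] that by blast
  show ?thesis
    unfolding Let_def using ac bc cd da db surj cB by (intro conjI impI) metis+
qed

end
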